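(* Let $-\infty<a<b<\infty$ and let $X$ be a real-valued random variable with $\mathbb{P}(X\in[a,b])=1$. Let $\{\varepsilon_n\}_{n\ge 0}$ be the primitive sequence associated with the law of $X$, and define the normalized sequence $$\gamma_n:=\frac{n!\,\varepsilon_n}{(b-a)^n}=\mathbb{E}\left[\left(\frac{b-X}{b-a}\right)^n\right]\in[0,1],\qquad n\ge 0.$$ Then the following hold. (a) The sequence $\{\gamma_n\}_n$ is non-increasing and bounded in $[0,1]$, and $\gamma_n\searrow\mathbb{P}(X=a)$ as $n\to\infty$. (b) For all $\delta\in(a,b)$, $$\gamma_n\le\mathbb{P}(X\le\delta)+\left(\frac{b-\delta}{b-a}\right)^n,\qquad n\ge 0.$$ (c) If there exists $\delta>0$ such that $\mathbb{P}(X\ge a+\delta)=1$, then $$\varepsilon_n\le\frac{(b-a-\delta)^n}{n!},\qquad n\ge 0.$$ (d) If $\mathbb{P}(X=a)>0$, then $$\lim_{n\to\infty}\frac{(n+1)\,\varepsilon_{n+1}}{\varepsilon_n}=b-a.$$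
   Context: Let $F_X(x)=\mathbb{P}(X\le x)$, $x\in\mathbb{R}$, be the cdf of $X$. Define $F_X^{(0)}:=F_X$ and recursively $F_X^{(-n)}(t):=\int_a^t F_X^{(-(n-1))}(x)\,dx$ for $n\ge 1$. The primitive sequence associated with the law of $X$ is $\varepsilon_n:=F_X^{(-n)}(b)$, $n\ge 0$; it satisfies $\varepsilon_n=\mathbb{E}[(b-X)^n]/n!$. Convention: $0^0=1$. *)

theory Defs
  imports "HOL-Probability.Probability"
begin

primrec iterated_primitive :: "real \<Rightarrow> (real \<Rightarrow> real) \<Rightarrow> nat \<Rightarrow> real \<Rightarrow> real" where
  "iterated_primitive a F 0 = F"
| "iterated_primitive a F (Suc n) = (\<lambda>t. LBINT x=ereal a..ereal t. iterated_primitive a F n x)"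

text \<open>
  The law \<open>\<mu>\<close> of a real random variable \<open>X\<close> on \<open>M\<close> is \<open>distr M borel X\<close>, so that
  \<open>cdf \<mu> x\<close> is the probability of \<open>X \<le> x\<close>.
\<close>

definition primitive_seq :: "real measure \<Rightarrow> real \<Rightarrow> real \<Rightarrow> nat \<Rightarrow> real" where
  "primitive_seq \<mu> a b n = iterated_primitive a (cdf \<mu>) n b"

definition normalized_primitive_seq :: "real measure \<Rightarrow> real \<Rightarrow> real \<Rightarrow> nat \<Rightarrow> real" where
  "normalized_primitive_seq \<mu> a b n = fact n * primitive_seq \<mu> a b n / (b - a) ^ n"

end

theory Submission
  imports Defs
begin

text \<open>This is the inner integral left over once Fubini has swapped the order in the induction
  for the iterated primitives: integrating the kernel \<open>(s - x) ^ n / fact n\<close> in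
  \<open>s\<close> raises the exponent and the factorial by one. Keeping the indicators on both
  sides lets the result match the next induction claim for every \<open>x\<close>, including those
  outside \<open>{a..t}\<close>.\<close>

lemma integral_power_diff:
  fixes a x t :: real
  shows "(LINT s|lborel. indicator {a..t} s * (indicator {a..s} x * ((s - x) ^ n / fact n)))
       = indicator {a..t} x * ((t - x) ^ Suc n / fact (Suc n))"
proof (cases "x \<in> {a..t}")
  case True
  \<comment> \<open>As a function of \<open>s\<close>, and with a <= x <= t, the two indicators
    multiply to the indicator of \<open>{x..t}\<close>.\<close>
  have "(LINT s|lborel. indicator {a..t} s * (indicator {a..s} x * ((s - x) ^ n / fact n)))
      = (LINT s|lborel. (s - x) ^ n / fact n * indicator {x..t} s)"
    using True by (intro Bochner_Integration.integral_cong) (auto simp: indicator_def)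
  \<comment> \<open>The boundary term at x vanishes because the exponent \<open>Suc n\<close> is
    positive, even for n = 0.\<close>
  also have "\<dots> = (t - x) ^ Suc n / fact (Suc n) - (x - x) ^ Suc n / fact (Suc n)"
  proof (rule integral_FTC_Icc_real[where F = "\<lambda>s. (s - x) ^ Suc n / fact (Suc n)"])
    show "x \<le> t" using True by simp
    show "((\<lambda>s. (s - x) ^ Suc n / fact (Suc n)) has_real_derivative (s - x) ^ n / fact n) (at s)" for s
    proof -
      have "((\<lambda>s. (s - x) ^ Suc n) has_real_derivative real (Suc n) * (s - x) ^ n) (at s)"
        by (auto intro!: derivative_eq_intros simp del: power_Suc)
      from DERIV_cdivide[OF this, of "fact (Suc n)"] show ?thesis
        by (simp add: fact_Suc del: of_nat_Suc power_Suc)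
    qed
  qed auto
  finally show ?thesis using True by simp
next
  case False
  then have zero: "(\<lambda>s. indicator {a..t} s * (indicator {a..s} x * ((s - x) ^ n / fact n)))
      = (\<lambda>s. 0 :: real)"
    by (auto simp: indicator_def fun_eq_iff)
  show ?thesis unfolding zero using False by simp
qed

text \<open>
  The indicator makes the case \<open>n = 0\<close> the distribution function itself (as \<open>0 ^ 0 = 1\<close>), and its
  lower endpoint \<open>a\<close> keeps the integrand bounded, so that Fubini applies without moment assumptions.
\<close>

lemma (in real_distribution) iterated_primitive_cdf:
  assumes ge: "AE x in M. a \<le> x" and "a \<le> t"
  shows "iterated_primitive a (cdf M) n t
       = (LINT x|M. indicator {a..t} x * ((t - x) ^ n / fact n))"
  using \<open>a \<le> t\<close>
proof (induction n arbitrary: t)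
  case 0
  \<comment> \<open>The half-line up to t and \<open>{a..t}\<close> differ only by points below a,
    which form a null set.\<close>
  have "cdf M t = measure M {a..t}"
    unfolding cdf_def using ge by (intro finite_measure_eq_AE) (auto elim: eventually_mono)
  then show ?case by simp
next
  case (Suc n)
  let ?f = "\<lambda>x s :: real. indicator {a..t} s * (indicator {a..s} x * ((s - x) ^ n / fact n)) :: real"
  interpret P: pair_sigma_finite M lborel ..
  \<comment> \<open>The set \<open>{a..s}\<close> moves with s, so joint measurability is checked on
    the inequalities a <= x <= s rather than on one fixed set.\<close>
  have meas: "(\<lambda>(x, s). ?f x s) \<in> borel_measurable (M \<Otimes>\<^sub>M lborel)"
    unfolding indicator_def of_bool_def by simp
  have "integrable (M \<Otimes>\<^sub>M lborel) (\<lambda>(x, s). ?f x s)"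
  \<comment> \<open>Where the integrand is nonzero, a <= x <= s <= t, hence 0 <= s - x <= t - a. The
    strip has finite product measure because M is a probability measure.\<close>
  proof (rule integrableI_bounded_set[where A = "UNIV \<times> {a..t}" and B = "(t - a) ^ n / fact n"])
    show "emeasure (M \<Otimes>\<^sub>M lborel) (UNIV \<times> {a..t}) < \<infinity>"
      using lborel.emeasure_pair_measure_Times[of UNIV M "{a..t}"] Suc.prems
      by (simp add: ennreal_mult_eq_top_iff less_top[symmetric] emeasure_finite)
    show "AE z in M \<Otimes>\<^sub>M lborel. z \<in> UNIV \<times> {a..t} \<longrightarrow>
        norm (case z of (x, s) \<Rightarrow> ?f x s) \<le> (t - a) ^ n / fact n"
      using Suc.prems
      by (intro AE_I2) (auto simp: indicator_def intro!: divide_right_mono power_mono)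
  qed (use meas in \<open>auto simp: indicator_def\<close>)
  then have swap: "(LINT s|lborel. LINT x|M. ?f x s) = (LINT x|M. LINT s|lborel. ?f x s)"
    by (rule P.Fubini_integral)
  have "iterated_primitive a (cdf M) (Suc n) t
      = (LINT s|lborel. indicator {a..t} s * iterated_primitive a (cdf M) n s)"
    using Suc.prems by (simp add: interval_integral_Icc set_lebesgue_integral_def)
  also have "\<dots> = (LINT s|lborel. LINT x|M. ?f x s)"
    \<comment> \<open>The induction hypothesis requires a <= s; for s outside \<open>{a..t}\<close>
      both integrands are zero.\<close>
    by (intro Bochner_Integration.integral_cong) (auto simp: Suc.IH indicator_def)
  finally show ?case
    by (simp only: swap integral_power_diff)
qed

text \<open>At t = b the indicator in the kernel formula equals 1 almost everywhere, so the
  truncated moment becomes the full one.\<close>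

lemma (in real_distribution) primitive_seq_eq_moment:
  assumes "AE x in M. x \<in> {a..b}" and "a \<le> b"
  shows "primitive_seq M a b n = (LINT x|M. (b - x) ^ n) / fact n"
proof -
  have "primitive_seq M a b n = (LINT x|M. indicator {a..b} x * ((b - x) ^ n / fact n))"
    unfolding primitive_seq_def
    using assms by (intro iterated_primitive_cdf) (auto elim: eventually_mono)
  also have "\<dots> = (LINT x|M. (b - x) ^ n / fact n)"
    using assms(1) by (intro integral_cong_AE) (auto elim: eventually_mono)
  finally show ?thesis by simp
qed

text \<open>Powers of a number in [0,1] stay in [0,1], decrease with the exponent, and converge to 1
  at the point 1 and to 0 elsewhere. Monotonicity of the integral and dominated convergence carry
  this over to expectations. It serves the rescaled variable (b - X) / (b - a).\<close>

lemma (in prob_space) moments_unit_interval: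
  fixes Y :: "'a \<Rightarrow> real"
  assumes [measurable]: "Y \<in> borel_measurable M" and Y: "AE \<omega> in M. Y \<omega> \<in> {0..1}"
  shows integrable_power_unit: "integrable M (\<lambda>\<omega>. Y \<omega> ^ n)"
    and moment_unit_bounds: "expectation (\<lambda>\<omega>. Y \<omega> ^ n) \<in> {0..1}"
    and decseq_moment_unit: "decseq (\<lambda>n. expectation (\<lambda>\<omega>. Y \<omega> ^ n))"
    and moment_unit_tendsto: "(\<lambda>n. expectation (\<lambda>\<omega>. Y \<omega> ^ n)) \<longlonglongrightarrow> \<P>(\<omega> in M. Y \<omega> = 1)"
proof -
  have pow: "AE \<omega> in M. 0 \<le> Y \<omega> ^ n \<and> Y \<omega> ^ n \<le> 1 \<and> Y \<omega> ^ Suc n \<le> Y \<omega> ^ n" for n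
    using Y by (rule eventually_mono) (auto simp: power_le_one intro: mult_left_le_one_le)
  then show int: "integrable M (\<lambda>\<omega>. Y \<omega> ^ n)" for n
    by (intro integrable_const_bound[where B = 1] eventually_mono[OF pow[of n]]) auto
  have "0 \<le> expectation (\<lambda>\<omega>. Y \<omega> ^ n)"
    using pow[of n] by (intro integral_nonneg_AE) auto
  moreover have "expectation (\<lambda>\<omega>. Y \<omega> ^ n) \<le> expectation (\<lambda>_. 1)"
    using pow[of n] int by (intro integral_mono_AE) auto
  ultimately show "expectation (\<lambda>\<omega>. Y \<omega> ^ n) \<in> {0..1}"
    by (simp add: prob_space)
  show "decseq (\<lambda>n. expectation (\<lambda>\<omega>. Y \<omega> ^ n))"
    using pow by (intro decseq_SucI integral_mono_AE int) auto
  have "(\<lambda>n. expectation (\<lambda>\<omega>. Y \<omega> ^ n)) \<longlonglongrightarrow>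
      expectation (indicator {\<omega> \<in> space M. Y \<omega> = 1})"
  proof (rule integral_dominated_convergence[where w = "\<lambda>_. 1"])
    show "AE \<omega> in M. (\<lambda>n. Y \<omega> ^ n) \<longlonglongrightarrow> indicator {\<omega> \<in> space M. Y \<omega> = 1} \<omega>"
      using Y AE_space
    proof eventually_elim
      case (elim \<omega>)
      show ?case
      proof (cases "Y \<omega> = 1")
        case True
        with elim show ?thesis by simp
      next
        case False
        with elim show ?thesis by (simp add: LIMSEQ_realpow_zero)
      qed
    qed
    show "AE \<omega> in M. norm (Y \<omega> ^ n) \<le> 1" for n
      using pow[of n] by (rule eventually_mono) auto
  qed auto
  then show "(\<lambda>n. expectation (\<lambda>\<omega>. Y \<omega> ^ n)) \<longlonglongrightarrow> \<P>(\<omega> in M. Y \<omega> = 1)"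
    by simp
qed

theorem corollary3:
  fixes M :: "'w measure" and X :: "'w \<Rightarrow> real" and a b :: real
    and \<epsilon> \<gamma> :: "nat \<Rightarrow> real"
  assumes "prob_space M"
    and "X \<in> borel_measurable M"
    and "a < b"
    and "\<P>(\<omega> in M. X \<omega> \<in> {a..b}) = 1"
    and "\<epsilon> = primitive_seq (distr M borel X) a b"
    and "\<gamma> = normalized_primitive_seq (distr M borel X) a b"
  shows
    "(\<forall>n. \<gamma> n = (\<integral>\<omega>. ((b - X \<omega>) / (b - a)) ^ n \<partial>M) \<and> \<gamma> n \<in> {0..1})
     \<and> (decseq \<gamma> \<and> (\<forall>n. \<gamma> n \<in> {0..1}) \<and> \<gamma> \<longlonglongrightarrow> \<P>(\<omega> in M. X \<omega> = a))
     \<and> (\<forall>\<delta>\<in>{a<..<b}. \<forall>n. \<gamma> n \<le> \<P>(\<omega> in M. X \<omega> \<le> \<delta>) + ((b - \<delta>) / (b - a)) ^ n)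
     \<and> (\<forall>\<delta>>0. \<P>(\<omega> in M. X \<omega> \<ge> a + \<delta>) = 1 \<longrightarrow> (\<forall>n. \<epsilon> n \<le> (b - a - \<delta>) ^ n / fact n))
     \<and> (\<P>(\<omega> in M. X \<omega> = a) > 0 \<longrightarrow>
          (\<lambda>n. real (n + 1) * \<epsilon> (n + 1) / \<epsilon> n) \<longlonglongrightarrow> b - a)"
proof -
  interpret prob_space M by fact
  note [measurable] = assms(2)
  define Y where "Y = (\<lambda>\<omega>. (b - X \<omega>) / (b - a))"
  have [measurable]: "Y \<in> borel_measurable M" by (simp add: Y_def)
  interpret D: real_distribution "distr M borel X"
    by (rule real_distribution_distr) simp
  have AE_X: "AE \<omega> in M. X \<omega> \<in> {a..b}"
    using assms(4) by (subst (asm) prob_Collect_eq_1) auto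
  have AE_Y: "AE \<omega> in M. Y \<omega> \<in> {0..1}"
    using \<open>a < b\<close> by (intro eventually_mono[OF AE_X]) (auto simp: Y_def)
  have "AE x in distr M borel X. x \<in> {a..b}"
    using AE_X by (subst AE_distr_iff) auto
  then have \<epsilon>: "\<epsilon> n = expectation (\<lambda>\<omega>. (b - X \<omega>) ^ n) / fact n" for n
    using \<open>a < b\<close> by (simp add: assms(5) D.primitive_seq_eq_moment integral_distr)
  have \<gamma>_\<epsilon>: "\<gamma> n = fact n * \<epsilon> n / (b - a) ^ n" for n
    by (simp add: assms(5,6) normalized_primitive_seq_def)
  have \<gamma>: "\<gamma> n = expectation (\<lambda>\<omega>. Y \<omega> ^ n)" for n
    by (simp add: \<gamma>_\<epsilon> \<epsilon> Y_def power_divide)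
  then have \<gamma>_fun: "\<gamma> = (\<lambda>n. expectation (\<lambda>\<omega>. Y \<omega> ^ n))" by auto
  note mom = moments_unit_interval[OF _ AE_Y]
  \<comment> \<open>This identifies the limit of the moments of Y, its mass at 1, with the mass of X
    at a.\<close>
  have "(Y \<omega> = 1) = (X \<omega> = a)" for \<omega>
    using \<open>a < b\<close> by (auto simp: Y_def field_simps)
  then have lim: "\<gamma> \<longlonglongrightarrow> \<P>(\<omega> in M. X \<omega> = a)"
    using mom(4) by (simp add: \<gamma>_fun)
  have bound_b: "\<gamma> n \<le> \<P>(\<omega> in M. X \<omega> \<le> \<delta>) + ((b - \<delta>) / (b - a)) ^ n"
    if "\<delta> \<in> {a<..<b}" for \<delta> n
  proof -
    let ?A = "{\<omega> \<in> space M. X \<omega> \<le> \<delta>}"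
    \<comment> \<open>Split at \<delta>: where X <= \<delta>, the indicator alone dominates
      \<open>Y \<omega> ^ n\<close>, which is at most 1; elsewhere Y is at most (b - \<delta>) / (b
      - a), and the constant term dominates.\<close>
    have "expectation (\<lambda>\<omega>. Y \<omega> ^ n)
        \<le> expectation (\<lambda>\<omega>. indicator ?A \<omega> + ((b - \<delta>) / (b - a)) ^ n)"
    proof (rule integral_mono_AE)
      show "AE \<omega> in M. Y \<omega> ^ n \<le> indicator ?A \<omega> + ((b - \<delta>) / (b - a)) ^ n"
        using AE_Y AE_space
      proof eventually_elim
        case (elim \<omega>)
        show ?case
        proof (cases "X \<omega> \<le> \<delta>")
          case True
          moreover have "Y \<omega> ^ n \<le> 1" using elim by (simp add: power_le_one)
          moreover have "0 \<le> ((b - \<delta>) / (b - a)) ^ n" using that by simp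
          ultimately show ?thesis using elim by simp
        next
          case False
          then have "Y \<omega> \<le> (b - \<delta>) / (b - a)"
            using \<open>a < b\<close> by (simp add: Y_def divide_right_mono)
          with False elim show ?thesis by (simp add: power_mono)
        qed
      qed
    qed (use mom(1) in \<open>auto intro!: Bochner_Integration.integrable_add integrable_real_indicator
      simp: less_top[symmetric]\<close>)
    also have "\<dots> = prob ?A + ((b - \<delta>) / (b - a)) ^ n"
      by (subst Bochner_Integration.integral_add)
        (auto simp: prob_space less_top[symmetric] intro!: integrable_real_indicator)
    finally show ?thesis by (simp add: \<gamma>)
  qed
  have bound_c: "\<epsilon> n \<le> (b - a - \<delta>) ^ n / fact n"
    if "\<P>(\<omega> in M. X \<omega> \<ge> a + \<delta>) = 1" for \<delta> n
  proof -
    have "AE \<omega> in M. a + \<delta> \<le> X \<omega>"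
      using that by (subst (asm) prob_Collect_eq_1) auto
    \<comment> \<open>\<open>AE_X\<close> supplies 0 <= b - X, which makes taking powers monotone
      here.\<close>
    with AE_X have "AE \<omega> in M. (b - X \<omega>) ^ n \<le> (b - a - \<delta>) ^ n"
      by eventually_elim (auto intro!: power_mono)
    \<comment> \<open>The integrand is the integrable power of Y scaled by
      \<open>(b - a) ^ n\<close>.\<close>
    moreover have "integrable M (\<lambda>\<omega>. (b - X \<omega>) ^ n)"
      using integrable_mult_right[OF mom(1)[of n], of "(b - a) ^ n"] \<open>a < b\<close>
      by (simp add: Y_def power_divide)
    ultimately have "expectation (\<lambda>\<omega>. (b - X \<omega>) ^ n) \<le> expectation (\<lambda>_. (b - a - \<delta>) ^ n)"
      by (intro integral_mono_AE) auto
    then show ?thesis by (simp add: \<epsilon> prob_space divide_right_mono)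
  qed
  have ratio: "(\<lambda>n. real (n + 1) * \<epsilon> (n + 1) / \<epsilon> n) \<longlonglongrightarrow> b - a"
    if "\<P>(\<omega> in M. X \<omega> = a) > 0"
  proof -
    \<comment> \<open>The factor n + 1 is the quotient of consecutive factorials, and the powers of
      b - a leave one factor b - a. If \<open>\<epsilon> n = 0\<close>, then
      \<open>\<gamma> n = 0\<close> too, and both sides are 0 because division by zero yields
      0.\<close>
    have "real (n + 1) * \<epsilon> (n + 1) / \<epsilon> n = (b - a) * (\<gamma> (Suc n) / \<gamma> n)" for n
    proof -
      define c where "c = b - a"
      have "c \<noteq> 0" using \<open>a < b\<close> by (simp add: c_def)
      then show ?thesis
        unfolding \<gamma>_\<epsilon> c_def[symmetric] by (cases "\<epsilon> n = 0") (simp_all add: field_simps)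
    qed
    \<comment> \<open>Numerator and denominator share the limit P(X = a); its positivity is what
      permits dividing the limits.\<close>
    moreover have "(\<lambda>n. (b - a) * (\<gamma> (Suc n) / \<gamma> n)) \<longlonglongrightarrow> (b - a) * 1"
      using tendsto_divide[OF LIMSEQ_Suc[OF lim] lim] that by (intro tendsto_mult) auto
    ultimately show ?thesis by simp
  qed
  show ?thesis
    using mom(2,3) lim bound_b bound_c ratio by (auto simp: \<gamma>_fun Y_def)
qed

end
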